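(* Consider the FlexPD-G iterates described in the context with integer $T\ge1$, and let $c_1=1+\alpha\rho(B)$. Choose $\eta_2>0$ and $\eta_3>\rho(B)$ with $\eta_2+\eta_3<2m-\rho(B)$. If $0<\alpha<\frac{\eta_2}{L^2}$ and $0<\beta<\frac{2m-(\eta_2+\eta_3)-\rho(B)}{\rho(A'A)}$, then there exists $\delta_G>0$ such that for all $k\ge0$, \[c_1\|x^{k+1,T}-x^*\|^2+\frac{\alpha}{\beta}\|\lambda^{k+1}-\lambda^*\|^2\le\frac{1}{1+\delta_G}\Big(\|x^{k+1,T-1}-x^*\|^2+\frac{\alpha}{\beta}\|\lambda^k-\lambda^*\|^2+\alpha\rho(B)\|x^k-x^*\|^2\Big).\]
   Context: Setting: $n$ agents are connected by a connected undirected graph with edge set $\mathcal E$, $\epsilon=|\mathcal E|$. For $x\in\mathbb R^n$ let $f(x)=\sum_{i=1}^n f_i(x_i)$, where each $f_i:\mathbb R\to\mathbb R$ is twice differentiable with $m\le f_i''\le L$ for constants $0<m\le L$; $\nabla f(x)=(f_1'(x_1),\dots,f_n'(x_n))'$. $A\in\mathbb R^{\epsilon\times n}$ is the edge–node incidence matrix (null space spanned by the all-ones vector). $B\in\mathbb R^{n\times n}$ is symmetric positive semidefinite with the same null space as $A$, off-diagonal entries nonzero only on edges, and $\rho(B)<m$. $x^*$ is the unique minimizer of $f$ subject to $Ax=0$ and $\lambda^*$ a Lagrange multiplier with $\nabla f(x^* )+A'\lambda^*=0$, $Ax^*=0$, $Bx^*=0$, chosen in the column space of $A$. FlexPD-G: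 given $\alpha,\beta>0$, $T\ge1$, $x^0$ arbitrary, $\lambda^0=0$; for $k\ge0$: $x^{k+1,0}=x^k$; for $t=1,\dots,T$, $x^{k+1,t}=x^{k+1,t-1}-\alpha\nabla f(x^{k+1,t-1})-\alpha A'\lambda^k-\alpha Bx^k$; then $x^{k+1}=x^{k+1,T}$, $\lambda^{k+1}=\lambda^k+\beta Ax^{k+1}$. Notation: $\rho(S)$ largest eigenvalue of symmetric $S$; $\|\cdot\|$ Euclidean norm. *)

theory Defs
  imports "HOL-Analysis.Analysis"
begin

text \<open>Largest eigenvalue of a (symmetric) real square matrix.\<close>
definition max_eig :: "real^'n^'n \<Rightarrow> real" where
  "max_eig S = Max {\<mu>. \<exists>v. v \<noteq> 0 \<and> S *v v = \<mu> *\<^sub>R v}"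

text \<open>Undirected graph on node type 'n with edge type 'e; each edge e joins
  the two distinct nodes fst (ends e) and snd (ends e) (an arbitrary orientation).\<close>
definition adjacent :: "('e \<Rightarrow> 'n \<times> 'n) \<Rightarrow> 'n \<Rightarrow> 'n \<Rightarrow> bool" where
  "adjacent ends i j \<longleftrightarrow> (\<exists>e. ends e = (i, j) \<or> ends e = (j, i))"

definition simple_graph :: "('e \<Rightarrow> 'n \<times> 'n) \<Rightarrow> bool" where
  "simple_graph ends \<longleftrightarrow> (\<forall>e. fst (ends e) \<noteq> snd (ends e)) \<and>
     (\<forall>e e'. ends e' = ends e \<or> ends e' = prod.swap (ends e) \<longrightarrow> e = e')"

definition connected_graph :: "('e \<Rightarrow> 'n \<times> 'n) \<Rightarrow> bool" where
  "connected_graph ends \<longleftrightarrow> (\<forall>i j. (i, j) \<in> {(u, v). adjacent ends u v}\<^sup>*)"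

text \<open>Edge-node incidence matrix.\<close>
definition incidence :: "('e \<Rightarrow> 'n \<times> 'n) \<Rightarrow> real^'n^'e" where
  "incidence ends = (\<chi> e i. if i = fst (ends e) then 1 else if i = snd (ends e) then -1 else 0)"

definition psd :: "real^'n^'n \<Rightarrow> bool" where
  "psd S \<longleftrightarrow> (\<forall>x. 0 \<le> x \<bullet> (S *v x))"

end

theory Submission
  imports Defs
begin

(* Write d, e, q for the errors x^{k+1,T-1} - x^star, x^{k+1,T} - x^star, x^k - x^star and mu, mu'
   for lambda^k - lambda^star, lambda^{k+1} - lambda^star. By the KKT conditions the last inner
   step reads e = u - alpha h with h = A' mu + B q, where u is a plain gradient step from d and
   hence contracts: |u|^2 <= (1 - alpha (2m - alpha L^2)) |d|^2. Expanding the dual update, the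
   gap between the bracket on the right and the left-hand side becomes
   |d|^2 - |u|^2 + alpha^2 |h|^2 + 2 alpha e'Bq - alpha beta |Ae|^2 plus rho(B) terms.
   Young's inequality, positive semidefiniteness of B and the Rayleigh bounds for B and A'A
   bound this gap below by kappa (|d|^2 + |e|^2 + |q|^2), where kappa > 0 comes from the slack
   in the step-size conditions. Since mu' lies in the range of A, on which A' is bounded below,
   the left-hand side is at most C (|d|^2 + |e|^2 + |q|^2), and delta = kappa / C works. *)

lemma inner_matrix_vector_symmetric:
  fixes S :: "real^'n^'n"
  assumes "transpose S = S"
  shows "x \<bullet> (S *v y) = y \<bullet> (S *v x)"
proof -
  have "x \<bullet> (S *v y) = (transpose S *v x) \<bullet> y"
    by (simp add: dot_lmul_matrix)
  then show ?thesis using assms by (simp add: inner_commute)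
qed

lemma eigenvectors_orthogonal:
  fixes S :: "real^'n^'n"
  assumes "transpose S = S" "S *v v = a *\<^sub>R v" "S *v w = b *\<^sub>R w" "a \<noteq> b"
  shows "v \<bullet> w = 0"
proof -
  have "b * (v \<bullet> w) = a * (v \<bullet> w)"
    using inner_matrix_vector_symmetric[OF assms(1), of v w] assms(2,3)
    by (simp add: inner_commute)
  then show ?thesis using assms(4) by simp
qed

lemma finite_eigenvalues_symmetric:
  fixes S :: "real^'n^'n"
  assumes "transpose S = S"
  shows "finite {\<mu>. \<exists>v. v \<noteq> 0 \<and> S *v v = \<mu> *\<^sub>R v}" (is "finite ?\<Lambda>")
proof -
  define V where "V \<mu> = (SOME v. v \<noteq> 0 \<and> S *v v = \<mu> *\<^sub>R v)" for \<mu>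
  have V: "V \<mu> \<noteq> 0" "S *v V \<mu> = \<mu> *\<^sub>R V \<mu>" if "\<mu> \<in> ?\<Lambda>" for \<mu>
    using someI_ex[OF that[unfolded mem_Collect_eq]] unfolding V_def by blast+
  have "inj_on V ?\<Lambda>"
  proof (rule inj_onI)
    fix a b assume a: "a \<in> ?\<Lambda>" and b: "b \<in> ?\<Lambda>" and "V a = V b"
    have "a *\<^sub>R V a = S *v V a" using V(2)[OF a] by simp
    also have "\<dots> = b *\<^sub>R V a" using V(2)[OF b] \<open>V a = V b\<close> by simp
    finally show "a = b" using V(1)[OF a] by simp
  qed
  moreover have "pairwise orthogonal (V ` ?\<Lambda>)"
  proof (rule pairwiseI)
    fix v w assume "v \<in> V ` ?\<Lambda>" "w \<in> V ` ?\<Lambda>" "v \<noteq> w"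
    then obtain a b where a: "a \<in> ?\<Lambda>" and b: "b \<in> ?\<Lambda>" and "v = V a" "w = V b" "a \<noteq> b"
      by blast
    then show "orthogonal v w"
      unfolding orthogonal_def using eigenvectors_orthogonal[OF assms V(2)[OF a] V(2)[OF b]] by simp
  qed
  then have "independent (V ` ?\<Lambda>)"
    by (rule pairwise_orthogonal_independent) (use V(1) in force)
  then have "finite (V ` ?\<Lambda>)" by (rule independent_imp_finite)
  ultimately show ?thesis by (rule finite_imageD[rotated])
qed

lemma linear_coeff_zero_if_nonneg:
  fixes a b :: real
  assumes "\<And>t. 0 \<le> a * t + b * t\<^sup>2"
  shows "a = 0"
proof (rule ccontr)
  assume "a \<noteq> 0"
  define c where "c = \<bar>b\<bar> + 1"
  have "c > 0" "b - c < 0" unfolding c_def by linarith+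
  have "a * (- a / c) + b * (- a / c)\<^sup>2 = a\<^sup>2 * (b - c) / c\<^sup>2"
    using \<open>c > 0\<close> by (simp add: power2_eq_square field_simps)
  also have "\<dots> < 0"
    using \<open>a \<noteq> 0\<close> \<open>c > 0\<close> \<open>b - c < 0\<close> by (simp add: divide_neg_pos mult_pos_neg)
  finally show False using assms[of "- a / c"] by linarith
qed

lemma nonneg_form_zero_imp_kernel:
  fixes f :: "'a::real_inner \<Rightarrow> 'a"
  assumes "linear f" and self_adjoint: "\<And>x y. x \<bullet> f y = y \<bullet> f x"
    and nonneg: "\<And>x. 0 \<le> x \<bullet> f x" and "v \<bullet> f v = 0"
  shows "f v = 0"
proof -
  have "2 * (w \<bullet> f v) = 0" for w
  proof (rule linear_coeff_zero_if_nonneg)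
    fix t
    have "(v + t *\<^sub>R w) \<bullet> f (v + t *\<^sub>R w) = 2 * (w \<bullet> f v) * t + (w \<bullet> f w) * t\<^sup>2"
      using \<open>v \<bullet> f v = 0\<close> self_adjoint[of v w]
      by (simp add: linear_add[OF \<open>linear f\<close>] linear_scale[OF \<open>linear f\<close>]
          inner_add_left inner_add_right power2_eq_square algebra_simps)
    then show "0 \<le> 2 * (w \<bullet> f v) * t + (w \<bullet> f w) * t\<^sup>2"
      using nonneg[of "v + t *\<^sub>R w"] by linarith
  qed
  from this[of "f v"] show ?thesis by simp
qed

text \<open>A maximiser \<open>v\<close> of the quadratic form on the unit sphere is an eigenvector: the form of
  \<open>\<mu> I - S\<close> is nonnegative and vanishes at \<open>v\<close>.\<close>

lemma symmetric_matrix_top_eigenvector: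
  fixes S :: "real^'n^'n"
  assumes sym: "transpose S = S"
  obtains v \<mu> where "v \<noteq> 0" "S *v v = \<mu> *\<^sub>R v" "\<And>x. x \<bullet> (S *v x) \<le> \<mu> * (norm x)\<^sup>2"
proof -
  let ?q = "\<lambda>x. x \<bullet> (S *v x)"
  have "continuous_on (sphere 0 1) ?q"
    by (intro continuous_intros linear_continuous_on matrix_vector_mul_bounded_linear)
  moreover have "sphere (0::real^'n) 1 \<noteq> {}" by simp
  ultimately obtain v where "v \<in> sphere 0 1" "\<forall>y\<in>sphere 0 1. ?q y \<le> ?q v"
    using continuous_attains_sup[OF compact_sphere] by blast
  then have v: "norm v = 1" and vmax: "\<And>y. norm y = 1 \<Longrightarrow> ?q y \<le> ?q v" by simp_all
  define \<mu> where "\<mu> = ?q v"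
  have bound: "?q x \<le> \<mu> * (norm x)\<^sup>2" for x
  proof (cases "x = 0")
    case False
    have "norm (x /\<^sub>R norm x) = 1" using False by simp
    then have "?q (x /\<^sub>R norm x) \<le> \<mu>" unfolding \<mu>_def by (rule vmax)
    moreover have "?q (x /\<^sub>R norm x) = ?q x / (norm x)\<^sup>2"
      by (simp add: matrix_vector_mult_scaleR power2_eq_square divide_inverse)
    ultimately show ?thesis using False by (simp add: pos_divide_le_eq)
  qed simp
  have "\<mu> *\<^sub>R v - S *v v = 0"
  proof (rule nonneg_form_zero_imp_kernel[where f = "\<lambda>x. \<mu> *\<^sub>R x - S *v x"])
    show "linear (\<lambda>x. \<mu> *\<^sub>R x - S *v x)"
      by (rule linearI) (simp_all add: matrix_vector_right_distrib matrix_vector_mult_scaleR algebra_simps)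
    show "x \<bullet> (\<mu> *\<^sub>R y - S *v y) = y \<bullet> (\<mu> *\<^sub>R x - S *v x)" for x y
      using inner_matrix_vector_symmetric[OF sym, of x y] by (simp add: inner_diff_right inner_commute)
    show "0 \<le> x \<bullet> (\<mu> *\<^sub>R x - S *v x)" for x
      using bound[of x] by (simp add: inner_diff_right power2_norm_eq_inner)
    show "v \<bullet> (\<mu> *\<^sub>R v - S *v v) = 0"
      using v by (simp add: inner_diff_right \<mu>_def power2_norm_eq_inner[symmetric])
  qed
  then have "S *v v = \<mu> *\<^sub>R v" by simp
  moreover have "v \<noteq> 0" using v by auto
  ultimately show ?thesis using that bound by blast
qed

lemma quadratic_form_le_max_eig:
  fixes S :: "real^'n^'n"
  assumes "transpose S = S"
  shows "x \<bullet> (S *v x) \<le> max_eig S * (norm x)\<^sup>2"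
proof -
  obtain v \<mu> where "v \<noteq> 0" "S *v v = \<mu> *\<^sub>R v" and bound: "x \<bullet> (S *v x) \<le> \<mu> * (norm x)\<^sup>2"
    using symmetric_matrix_top_eigenvector[OF assms] by metis
  then have "\<mu> \<le> max_eig S"
    unfolding max_eig_def by (intro Max_ge finite_eigenvalues_symmetric[OF assms]) auto
  then show ?thesis using bound by (meson mult_right_mono order_trans zero_le_power2)
qed

lemma max_eig_nonneg:
  fixes S :: "real^'n^'n"
  assumes "transpose S = S" "psd S"
  shows "0 \<le> max_eig S"
  using quadratic_form_le_max_eig[OF assms(1), of "axis undefined 1"] assms(2)
  by (simp add: psd_def) (metis order_trans)

lemma max_eig_pos:
  fixes S :: "real^'n^'n"
  assumes sym: "transpose S = S" and "psd S" "S \<noteq> 0"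
  shows "0 < max_eig S"
proof (rule ccontr)
  assume "\<not> 0 < max_eig S"
  have form_zero: "x \<bullet> (S *v x) = 0" for x
  proof -
    have "x \<bullet> (S *v x) \<le> 0"
      using quadratic_form_le_max_eig[OF sym, of x] \<open>\<not> 0 < max_eig S\<close>
      by (meson mult_nonpos_nonneg not_less order_trans zero_le_power2)
    then show ?thesis using \<open>psd S\<close> unfolding psd_def by (simp add: order_antisym)
  qed
  have "S *v x = 0" for x
    using nonneg_form_zero_imp_kernel[OF matrix_vector_mul_linear, of S x]
      inner_matrix_vector_symmetric[OF sym] form_zero by simp
  then show False using \<open>S \<noteq> 0\<close> by (simp add: matrix_eq)
qed

lemma psd_cross_term_lower_bound:
  fixes B :: "real^'n^'n"
  assumes sym: "transpose B = B" and "psd B" and "0 < t"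
  shows "- (t * (e \<bullet> (B *v e)) + (p \<bullet> (B *v p)) / t) \<le> 2 * (e \<bullet> (B *v p))"
proof -
  have "0 \<le> (t *\<^sub>R e + p) \<bullet> (B *v (t *\<^sub>R e + p))" using \<open>psd B\<close> unfolding psd_def by blast
  also have "\<dots> = t * (t * (e \<bullet> (B *v e)) + 2 * (e \<bullet> (B *v p)) + (p \<bullet> (B *v p)) / t)"
    using \<open>0 < t\<close> inner_matrix_vector_symmetric[OF sym, of p e]
    by (simp add: matrix_vector_right_distrib matrix_vector_mult_scaleR inner_add_left
        inner_add_right power2_eq_square algebra_simps)
  finally show ?thesis using \<open>0 < t\<close> by (simp add: zero_le_mult_iff)
qed

lemma transpose_bounded_below_on_range:
  fixes A :: "real^'n^'m"
  obtains \<sigma> where "0 < \<sigma>" "\<And>z. \<sigma> * norm (A *v z) \<le> norm (transpose A *v (A *v z))"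
proof -
  have "subspace (range ((*v) A))"
    by (rule linear_subspace_image[OF matrix_vector_mul_linear subspace_UNIV])
  moreover have "A *v z = 0" if "transpose A *v (A *v z) = 0" for z
    using that dot_lmul_matrix[of "A *v z" A z] by simp
  ultimately obtain \<sigma> where "0 < \<sigma>" "\<forall>y\<in>range ((*v) A). \<sigma> * norm y \<le> norm (transpose A *v y)"
    using injective_imp_isometric[of "range ((*v) A)" "(*v) (transpose A)"]
    by (auto simp: closed_subspace matrix_vector_mul_bounded_linear)
  then show ?thesis using that by blast
qed

lemma power2_norm_diff_le:
  fixes x y :: "'a::real_inner"
  shows "(norm (x - y))\<^sup>2 \<le> 2 * (norm x)\<^sup>2 + 2 * (norm y)\<^sup>2"
proof -
  have "(norm (x - y))\<^sup>2 + (norm (x + y))\<^sup>2 = 2 * (norm x)\<^sup>2 + 2 * (norm y)\<^sup>2"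
    unfolding power2_norm_eq_inner
    by (simp add: inner_add_left inner_add_right inner_diff_left inner_diff_right inner_commute)
  then show ?thesis by (smt (verit) zero_le_power2)
qed

lemma power2_norm_add3_le:
  fixes x y z :: "'a::real_normed_vector"
  shows "(norm (x + y + z))\<^sup>2 \<le> 3 * ((norm x)\<^sup>2 + (norm y)\<^sup>2 + (norm z)\<^sup>2)"
proof -
  have "norm (x + y + z) \<le> norm x + norm y + norm z"
    by (meson add_mono norm_triangle_ineq order_trans order_refl)
  then have "(norm (x + y + z))\<^sup>2 \<le> (norm x + norm y + norm z)\<^sup>2"
    by (simp add: power_mono)
  also have "\<dots> \<le> 3 * ((norm x)\<^sup>2 + (norm y)\<^sup>2 + (norm z)\<^sup>2)"
    using sum_squares_ge_zero[of "norm x - norm y" "norm y - norm z"]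
      zero_le_power2[of "norm x - norm z"]
    by (simp add: power2_eq_square algebra_simps)
  finally show ?thesis .
qed

lemma norm_diff_tradeoff:
  fixes u v :: "'a::real_inner"
  assumes "0 < a" "a < 1" and u_small: "(norm u)\<^sup>2 \<le> (1 - a) * (1 - g) * D"
  shows "g * D + a * (norm (u - v))\<^sup>2 \<le> D - (norm u)\<^sup>2 + (norm v)\<^sup>2"
proof -
  have "a * (norm u)\<^sup>2 + (1 - a) * (norm v)\<^sup>2 - (1 - a) * (a * (norm (u - v))\<^sup>2)
      = (norm (a *\<^sub>R u + (1 - a) *\<^sub>R v))\<^sup>2"
    unfolding power2_norm_eq_inner
    by (simp add: inner_add_left inner_add_right inner_diff_left inner_diff_right
        inner_commute power2_eq_square algebra_simps)
  then have "(1 - a) * (a * (norm (u - v))\<^sup>2) \<le> a * (norm u)\<^sup>2 + (1 - a) * (norm v)\<^sup>2"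
    by (smt (verit) zero_le_power2)
  then have "(1 - a) * (g * D + a * (norm (u - v))\<^sup>2) \<le> (1 - a) * (D - (norm u)\<^sup>2 + (norm v)\<^sup>2)"
    using u_small by (simp add: algebra_simps)
  then show ?thesis using \<open>a < 1\<close> by simp
qed

lemma gradient_step_contraction:
  fixes g :: "'a::real_inner \<Rightarrow> 'a"
  assumes mono: "m * (norm (y - x))\<^sup>2 \<le> (g y - g x) \<bullet> (y - x)"
    and lip: "norm (g y - g x) \<le> L * norm (y - x)" and "0 \<le> \<alpha>"
  shows "(norm ((y - x) - \<alpha> *\<^sub>R (g y - g x)))\<^sup>2 \<le> (1 - \<alpha> * (2 * m - \<alpha> * L\<^sup>2)) * (norm (y - x))\<^sup>2"
proof -
  have "(norm (g y - g x))\<^sup>2 \<le> L\<^sup>2 * (norm (y - x))\<^sup>2"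
    using lip by (metis norm_ge_zero power_mono power_mult_distrib)
  then have "\<alpha>\<^sup>2 * (norm (g y - g x))\<^sup>2 \<le> \<alpha>\<^sup>2 * (L\<^sup>2 * (norm (y - x))\<^sup>2)"
    by (simp add: mult_left_mono)
  moreover have "\<alpha> * (m * (norm (y - x))\<^sup>2) \<le> \<alpha> * ((g y - g x) \<bullet> (y - x))"
    using mono \<open>0 \<le> \<alpha>\<close> by (simp add: mult_left_mono)
  moreover have "(norm ((y - x) - \<alpha> *\<^sub>R (g y - g x)))\<^sup>2
      = (norm (y - x))\<^sup>2 - 2 * (\<alpha> * ((g y - g x) \<bullet> (y - x))) + \<alpha>\<^sup>2 * (norm (g y - g x))\<^sup>2"
    unfolding power2_norm_eq_inner
    by (simp add: inner_diff_left inner_diff_right inner_commute power2_eq_square algebra_simps)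
  moreover have "(1 - \<alpha> * (2 * m - \<alpha> * L\<^sup>2)) * (norm (y - x))\<^sup>2
      = (norm (y - x))\<^sup>2 - 2 * (\<alpha> * (m * (norm (y - x))\<^sup>2)) + \<alpha>\<^sup>2 * (L\<^sup>2 * (norm (y - x))\<^sup>2)"
    by (simp add: power2_eq_square algebra_simps)
  ultimately show ?thesis by linarith
qed

lemma mean_value_second_derivative:
  fixes df d2f :: "real \<Rightarrow> real"
  assumes "\<And>t. (df has_real_derivative d2f t) (at t)"
  obtains z where "df a - df b = d2f z * (a - b)"
proof -
  have "\<exists>z. df a - df b = d2f z * (a - b)" if "b < a" for a b
    using MVT2[OF that, of df d2f] assms by (metis mult.commute)
  then have "\<exists>z. df a - df b = d2f z * (a - b)"
    by (cases a b rule: linorder_cases) (auto, metis minus_diff_eq mult_minus_right)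
  then show ?thesis using that by blast
qed

lemma separable_gradient_strongly_monotone:
  fixes df d2f :: "'n::finite \<Rightarrow> real \<Rightarrow> real"
  assumes "\<And>i t. (df i has_real_derivative d2f i t) (at t)" and "\<And>i t. m \<le> d2f i t"
  shows "m * (norm (y - x))\<^sup>2 \<le> ((\<chi> i. df i (y $ i)) - (\<chi> i. df i (x $ i))) \<bullet> (y - x)"
proof -
  have "m * (y $ i - x $ i)\<^sup>2 \<le> (df i (y $ i) - df i (x $ i)) * (y $ i - x $ i)" for i
  proof -
    obtain z where "df i (y $ i) - df i (x $ i) = d2f i z * (y $ i - x $ i)"
      using mean_value_second_derivative assms(1) by metis
    moreover have "m * (y $ i - x $ i)\<^sup>2 \<le> d2f i z * (y $ i - x $ i)\<^sup>2"
      using assms(2) by (simp add: mult_right_mono)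
    ultimately show ?thesis by (simp add: power2_eq_square mult.assoc)
  qed
  then show ?thesis
    by (simp add: power2_norm_eq_inner inner_vec_def sum_distrib_left sum_mono
        flip: power2_eq_square)
qed

lemma separable_gradient_lipschitz:
  fixes df d2f :: "'n::finite \<Rightarrow> real \<Rightarrow> real"
  assumes "\<And>i t. (df i has_real_derivative d2f i t) (at t)"
    and "\<And>i t. 0 \<le> d2f i t \<and> d2f i t \<le> L"
  shows "norm ((\<chi> i. df i (y $ i)) - (\<chi> i. df i (x $ i))) \<le> L * norm (y - x)"
proof -
  have "(df i (y $ i) - df i (x $ i))\<^sup>2 \<le> L\<^sup>2 * (y $ i - x $ i)\<^sup>2" for i
  proof -
    obtain z where "df i (y $ i) - df i (x $ i) = d2f i z * (y $ i - x $ i)"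
      using mean_value_second_derivative assms(1) by metis
    moreover have "(d2f i z)\<^sup>2 \<le> L\<^sup>2" using assms(2)[of i z] by (simp add: power_mono)
    ultimately show ?thesis by (simp add: power_mult_distrib mult_right_mono)
  qed
  then have "(norm ((\<chi> i. df i (y $ i)) - (\<chi> i. df i (x $ i))))\<^sup>2 \<le> (L * norm (y - x))\<^sup>2"
    by (simp add: power2_norm_eq_inner inner_vec_def power_mult_distrib sum_distrib_left
        sum_mono flip: power2_eq_square)
  moreover have "0 \<le> L" using assms(2) order_trans by blast
  ultimately show ?thesis by (simp add: power2_le_iff_abs_le)
qed

lemma dual_gap_identity:
  fixes A :: "real^'n^'e"
  assumes "e = u - \<alpha> *\<^sub>R h" and "\<mu>' = \<mu> + \<beta> *\<^sub>R (A *v e)"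
    and "transpose A *v \<mu> = h - r" and "\<beta> \<noteq> 0"
  shows "\<alpha> / \<beta> * (norm \<mu>)\<^sup>2 - \<alpha> / \<beta> * (norm \<mu>')\<^sup>2 - (norm e)\<^sup>2
    = \<alpha>\<^sup>2 * (norm h)\<^sup>2 - (norm u)\<^sup>2 + 2 * \<alpha> * (e \<bullet> r) - \<alpha> * \<beta> * (norm (A *v e))\<^sup>2"
proof -
  have "\<mu> \<bullet> (A *v e) = (h - r) \<bullet> e"
    using assms(3) by (metis dot_lmul_matrix transpose_matrix_vector)
  then have cross: "\<mu> \<bullet> (A *v e) = e \<bullet> h - e \<bullet> r"
    by (simp add: inner_diff_right inner_commute)
  have \<mu>': "(norm \<mu>')\<^sup>2 = (norm \<mu>)\<^sup>2 + 2 * \<beta> * (e \<bullet> h - e \<bullet> r) + \<beta>\<^sup>2 * (norm (A *v e))\<^sup>2"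
    unfolding assms(2) power2_norm_eq_inner
    by (simp add: inner_add_left inner_add_right cross inner_commute[of "A *v e" \<mu>]
        power2_eq_square algebra_simps)
  have u: "(norm u)\<^sup>2 = (norm e)\<^sup>2 + 2 * \<alpha> * (e \<bullet> h) + \<alpha>\<^sup>2 * (norm h)\<^sup>2"
    unfolding assms(1) power2_norm_eq_inner
    by (simp add: inner_add_left inner_add_right inner_diff_left inner_diff_right
        inner_commute power2_eq_square algebra_simps)
  show ?thesis unfolding \<mu>' u using assms(4) by (simp add: field_simps power2_eq_square)
qed

lemma le_divide_one_plus_if_gap:
  fixes E W R C \<kappa> :: real
  assumes "0 < \<kappa>" "0 < C" "E \<le> C * W" "\<kappa> * W \<le> R - E"
  shows "E \<le> 1 / (1 + \<kappa> / C) * R"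
proof -
  have "\<kappa> / C * E \<le> \<kappa> * W"
    using assms(1-3) by (simp add: field_simps mult_left_mono)
  then have "(1 + \<kappa> / C) * E \<le> R" using assms(4) by (simp add: algebra_simps)
  moreover have "0 < 1 + \<kappa> / C" using assms(1,2) by (simp add: add_pos_pos)
  ultimately show ?thesis by (simp add: field_simps)
qed

lemma gram_quadratic_form:
  fixes A :: "real^'n^'m"
  shows "x \<bullet> ((transpose A ** A) *v x) = (norm (A *v x))\<^sup>2"
proof -
  have "x \<bullet> ((transpose A ** A) *v x) = (transpose A *v (A *v x)) \<bullet> x"
    by (simp add: matrix_vector_mul_assoc inner_commute)
  also have "\<dots> = (A *v x) \<bullet> (A *v x)" by (simp add: dot_lmul_matrix)
  finally show ?thesis by (simp add: power2_norm_eq_inner)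
qed

lemma power2_norm_matrix_vector_le:
  fixes M :: "real^'n^'m"
  shows "(norm (M *v x))\<^sup>2 \<le> (onorm ((*v) M))\<^sup>2 * (norm x)\<^sup>2"
proof -
  have "norm (M *v x) \<le> onorm ((*v) M) * norm x"
    by (rule onorm[OF matrix_vector_mul_bounded_linear])
  then show ?thesis by (simp add: power_mono flip: power_mult_distrib)
qed

lemma iterates_in_range:
  fixes A :: "real^'n^'e"
  assumes "lam 0 = 0" and "\<And>k. lam (Suc k) = lam k + \<beta> *\<^sub>R (A *v x (Suc k))"
  shows "lam k \<in> range ((*v) A)"
proof (induction k)
  case 0
  show ?case using assms(1) by (metis matrix_vector_mult_0_right rangeI)
next
  case (Suc k)
  then obtain z where "lam k = A *v z" by blast
  then have "lam (Suc k) = A *v (z + \<beta> *\<^sub>R x (Suc k))"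
    using assms(2) by (simp add: matrix_vector_right_distrib matrix_vector_mult_scaleR)
  then show ?case by simp
qed

text \<open>\<open>0 < \<rho>(B)\<close>, which follows from \<open>A \<noteq> 0\<close>, is needed to split the cross term \<open>e' B q\<close>.\<close>

locale flexpd_g =
  fixes A :: "real^'n::finite^'e::finite" and B :: "real^'n^'n" and grad :: "real^'n \<Rightarrow> real^'n"
    and m L \<alpha> \<beta> :: real and xs :: "real^'n" and ls :: "real^'e"
  assumes grad_strongly_monotone: "\<And>x y. m * (norm (y - x))\<^sup>2 \<le> (grad y - grad x) \<bullet> (y - x)"
    and grad_lipschitz: "\<And>x y. norm (grad y - grad x) \<le> L * norm (y - x)"
    and B_symmetric: "transpose B = B" and B_psd: "psd B" and B_max_eig_pos: "0 < max_eig B"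
    and kkt: "grad xs + transpose A *v ls = 0" "A *v xs = 0" "B *v xs = 0"
    and ls_range: "ls \<in> range ((*v) A)"
    and \<alpha>_pos: "0 < \<alpha>" and \<beta>_pos: "0 < \<beta>"
    and step_sizes: "\<alpha> * L\<^sup>2 + \<beta> * max_eig (transpose A ** A) + 2 * max_eig B < 2 * m"
begin

abbreviation \<rho>B :: real where "\<rho>B \<equiv> max_eig B"
abbreviation \<rho>A :: real where "\<rho>A \<equiv> max_eig (transpose A ** A)"

text \<open>With \<open>y = x\<^bsup>k+1,T-1\<^esup>\<close>, \<open>p = x\<^sup>k\<close> and \<open>lam = \<lambda>\<^sup>k\<close>, \<open>primal_step\<close> is the last inner step
  producing \<open>x\<^bsup>k+1,T\<^esup>\<close>, and \<open>dual_step\<close> produces \<open>\<lambda>\<^bsup>k+1\<^esup>\<close>.\<close>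

definition primal_step :: "real^'n \<Rightarrow> real^'n \<Rightarrow> real^'e \<Rightarrow> real^'n" where
  "primal_step y p lam = y - \<alpha> *\<^sub>R grad y - \<alpha> *\<^sub>R (transpose A *v lam) - \<alpha> *\<^sub>R (B *v p)"

definition dual_step :: "real^'n \<Rightarrow> real^'n \<Rightarrow> real^'e \<Rightarrow> real^'e" where
  "dual_step y p lam = lam + \<beta> *\<^sub>R (A *v primal_step y p lam)"

definition slack :: real where
  "slack = 2 * m - \<alpha> * L\<^sup>2 - \<beta> * \<rho>A - 2 * \<rho>B"

text \<open>The \<open>\<kappa>\<close> of the proof idea.\<close>

definition gap_rate :: real where
  "gap_rate = \<alpha> * slack * \<rho>B / (4 * \<rho>B + slack)"

lemma slack_pos: "0 < slack"
  using step_sizes unfolding slack_def by linarith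

lemma gram_max_eig_nonneg: "0 \<le> \<rho>A"
  by (rule max_eig_nonneg) (simp_all add: matrix_transpose_mul psd_def gram_quadratic_form)

lemma gap_rate_pos: "0 < gap_rate"
  unfolding gap_rate_def using \<alpha>_pos slack_pos B_max_eig_pos by simp

lemma primal_error:
  "primal_step y p lam - xs
    = ((y - xs) - \<alpha> *\<^sub>R (grad y - grad xs)) - \<alpha> *\<^sub>R (transpose A *v (lam - ls) + B *v (p - xs))"
proof -
  have "grad xs = - (transpose A *v ls)" using kkt(1) by (simp add: eq_neg_iff_add_eq_0)
  moreover have "transpose A *v (lam - ls) = transpose A *v lam - transpose A *v ls"
    and "B *v (p - xs) = B *v p" using kkt(3) by (simp_all add: matrix_vector_mult_diff_distrib)
  ultimately show ?thesis unfolding primal_step_def by (simp add: algebra_simps)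
qed

lemma dual_error:
  "dual_step y p lam - ls = (lam - ls) + \<beta> *\<^sub>R (A *v (primal_step y p lam - xs))"
proof -
  have "A *v (primal_step y p lam - xs) = A *v primal_step y p lam"
    using kkt(2) by (simp add: matrix_vector_mult_diff_distrib)
  then show ?thesis unfolding dual_step_def by simp
qed

lemma gradient_step_factor:
  "(norm ((y - x) - \<alpha> *\<^sub>R (grad y - grad x)))\<^sup>2 \<le> (1 - \<alpha> * (2 * m - \<alpha> * L\<^sup>2)) * (norm (y - x))\<^sup>2"
  using gradient_step_contraction[where g = grad, OF grad_strongly_monotone grad_lipschitz] \<alpha>_pos
  by simp

lemma gradient_step_factor_bounds:
  "0 \<le> 1 - \<alpha> * (2 * m - \<alpha> * L\<^sup>2)" "1 - \<alpha> * (2 * m - \<alpha> * L\<^sup>2) \<le> 1"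
proof -
  have "0 \<le> (1 - \<alpha> * (2 * m - \<alpha> * L\<^sup>2)) * (norm (axis undefined 1 - 0 :: real^'n))\<^sup>2"
    using gradient_step_factor[of "axis undefined 1" 0] by (meson order_trans zero_le_power2)
  then show "0 \<le> 1 - \<alpha> * (2 * m - \<alpha> * L\<^sup>2)" by (simp add: norm_axis_1)
  have "0 \<le> \<beta> * \<rho>A"
    using \<beta>_pos gram_max_eig_nonneg by simp
  then have "0 \<le> 2 * m - \<alpha> * L\<^sup>2" using step_sizes B_max_eig_pos by linarith
  then show "1 - \<alpha> * (2 * m - \<alpha> * L\<^sup>2) \<le> 1" using \<alpha>_pos by simp
qed

lemma cross_term_lower_bound:
  "- ((\<rho>B + slack / 4) * (norm e)\<^sup>2 + 4 * \<rho>B\<^sup>2 / (4 * \<rho>B + slack) * (norm q)\<^sup>2)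
    \<le> 2 * (e \<bullet> (B *v q))"
proof -
  define t where "t = (4 * \<rho>B + slack) / (4 * \<rho>B)"
  have "0 < t" unfolding t_def using B_max_eig_pos slack_pos by simp
  have "t * (e \<bullet> (B *v e)) \<le> t * (\<rho>B * (norm e)\<^sup>2)"
    using quadratic_form_le_max_eig[OF B_symmetric, of e] \<open>0 < t\<close> by simp
  moreover have "(q \<bullet> (B *v q)) / t \<le> (\<rho>B * (norm q)\<^sup>2) / t"
    using quadratic_form_le_max_eig[OF B_symmetric, of q] \<open>0 < t\<close> by (simp add: divide_right_mono)
  moreover have "t * (\<rho>B * (norm e)\<^sup>2) = (\<rho>B + slack / 4) * (norm e)\<^sup>2"
    unfolding t_def using B_max_eig_pos by (simp add: field_simps)
  moreover have "(\<rho>B * (norm q)\<^sup>2) / t = 4 * \<rho>B\<^sup>2 / (4 * \<rho>B + slack) * (norm q)\<^sup>2"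
    unfolding t_def using B_max_eig_pos slack_pos by (simp add: field_simps power2_eq_square)
  ultimately show ?thesis
    using psd_cross_term_lower_bound[OF B_symmetric B_psd \<open>0 < t\<close>, of e q] by linarith
qed

lemma primal_descent:
  fixes e u h :: "real^'n"
  assumes "e = u - \<alpha> *\<^sub>R h" and "(norm u)\<^sup>2 \<le> (1 - \<alpha> * (2 * m - \<alpha> * L\<^sup>2)) * D" and "0 \<le> D"
  shows "\<alpha> * slack / 2 * D + \<alpha> * (slack / 2 + \<beta> * \<rho>A + 2 * \<rho>B) * (norm e)\<^sup>2
    \<le> D - (norm u)\<^sup>2 + \<alpha>\<^sup>2 * (norm h)\<^sup>2"
proof -
  define a where "a = \<alpha> * (slack / 2 + \<beta> * \<rho>A + 2 * \<rho>B)"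
  have "0 \<le> \<beta> * \<rho>A" using \<beta>_pos gram_max_eig_nonneg by simp
  then have "0 < a" unfolding a_def using \<alpha>_pos slack_pos B_max_eig_pos by simp
  have split: "a + \<alpha> * slack / 2 = \<alpha> * (2 * m - \<alpha> * L\<^sup>2)"
    unfolding a_def slack_def by (simp add: algebra_simps)
  moreover have "0 < \<alpha> * slack / 2" using \<alpha>_pos slack_pos by simp
  ultimately have "a < 1" using gradient_step_factor_bounds(1) by linarith
  have "(1 - a) * (1 - \<alpha> * slack / 2) = 1 - (a + \<alpha> * slack / 2) + a * (\<alpha> * slack / 2)"
    by (simp add: field_simps)
  moreover have "0 \<le> a * (\<alpha> * slack / 2)" using \<open>0 < a\<close> \<alpha>_pos slack_pos by simp
  ultimately have "1 - \<alpha> * (2 * m - \<alpha> * L\<^sup>2) \<le> (1 - a) * (1 - \<alpha> * slack / 2)"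
    unfolding split by linarith
  then have "(norm u)\<^sup>2 \<le> (1 - a) * (1 - \<alpha> * slack / 2) * D"
    using assms(2,3) by (meson mult_right_mono order_trans)
  from norm_diff_tradeoff[OF \<open>0 < a\<close> \<open>a < 1\<close> this, of "\<alpha> *\<^sub>R h"]
  show ?thesis using assms(1) \<alpha>_pos by (simp add: a_def power_mult_distrib)
qed

lemma gap_rate_le_weights:
  assumes "0 \<le> D" "0 \<le> E"
  shows "gap_rate * (D + E + P) \<le> \<alpha> * slack / 2 * D + \<alpha> * slack / 4 * E
    + (\<alpha> * \<rho>B * P - \<alpha> * (4 * \<rho>B\<^sup>2 / (4 * \<rho>B + slack)) * P)"
proof -
  have rate: "gap_rate = \<alpha> * \<rho>B - \<alpha> * (4 * \<rho>B\<^sup>2 / (4 * \<rho>B + slack))"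
    unfolding gap_rate_def using B_max_eig_pos slack_pos by (simp add: field_simps power2_eq_square)
  have "\<rho>B / (4 * \<rho>B + slack) \<le> 1 / 4"
    using B_max_eig_pos slack_pos by (simp add: divide_simps)
  then have "(\<alpha> * slack) * (\<rho>B / (4 * \<rho>B + slack)) \<le> (\<alpha> * slack) * (1 / 4)"
    by (rule mult_left_mono) (use \<alpha>_pos slack_pos in simp)
  then have quarter: "gap_rate \<le> \<alpha> * slack / 4" unfolding gap_rate_def by simp
  then have "gap_rate \<le> \<alpha> * slack / 2" using mult_pos_pos[OF \<alpha>_pos slack_pos] by linarith
  then have "gap_rate * D \<le> \<alpha> * slack / 2 * D" using assms(1) by (rule mult_right_mono)
  moreover have "gap_rate * E \<le> \<alpha> * slack / 4 * E" using quarter assms(2) by (rule mult_right_mono)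
  moreover have "gap_rate * P = \<alpha> * \<rho>B * P - \<alpha> * (4 * \<rho>B\<^sup>2 / (4 * \<rho>B + slack)) * P"
    unfolding rate by (simp add: algebra_simps)
  moreover have "gap_rate * (D + E + P) = gap_rate * D + gap_rate * E + gap_rate * P"
    by (simp add: algebra_simps)
  ultimately show ?thesis by linarith
qed

lemma energy_gap_lower_bound:
  "gap_rate * ((norm (y - xs))\<^sup>2 + (norm (primal_step y p lam - xs))\<^sup>2 + (norm (p - xs))\<^sup>2)
    \<le> (norm (y - xs))\<^sup>2 + \<alpha> / \<beta> * (norm (lam - ls))\<^sup>2 + \<alpha> * \<rho>B * (norm (p - xs))\<^sup>2
      - ((1 + \<alpha> * \<rho>B) * (norm (primal_step y p lam - xs))\<^sup>2
        + \<alpha> / \<beta> * (norm (dual_step y p lam - ls))\<^sup>2)"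
proof -
  define e u h where "e = primal_step y p lam - xs"
    and "u = (y - xs) - \<alpha> *\<^sub>R (grad y - grad xs)"
    and "h = transpose A *v (lam - ls) + B *v (p - xs)"
  define D E P where "D = (norm (y - xs))\<^sup>2" and "E = (norm e)\<^sup>2" and "P = (norm (p - xs))\<^sup>2"
  have e_eq: "e = u - \<alpha> *\<^sub>R h" unfolding e_def u_def h_def by (rule primal_error)
  have gap: "\<alpha> / \<beta> * (norm (lam - ls))\<^sup>2 - \<alpha> / \<beta> * (norm (dual_step y p lam - ls))\<^sup>2 - E
      = \<alpha>\<^sup>2 * (norm h)\<^sup>2 - (norm u)\<^sup>2 + 2 * \<alpha> * (e \<bullet> (B *v (p - xs)))
        - \<alpha> * \<beta> * (norm (A *v e))\<^sup>2"
    unfolding E_def using e_eq dual_error[of y p lam] \<beta>_pos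
    by (intro dual_gap_identity) (simp_all add: e_def h_def matrix_vector_right_distrib)
  have descent: "\<alpha> * slack / 2 * D + \<alpha> * (slack / 2 + \<beta> * \<rho>A + 2 * \<rho>B) * E
      \<le> D - (norm u)\<^sup>2 + \<alpha>\<^sup>2 * (norm h)\<^sup>2"
    unfolding D_def E_def using e_eq gradient_step_factor[of y xs]
    by (intro primal_descent) (simp_all add: u_def)
  have cross: "- (\<alpha> * (\<rho>B + slack / 4) * E + \<alpha> * (4 * \<rho>B\<^sup>2 / (4 * \<rho>B + slack)) * P)
      \<le> 2 * \<alpha> * (e \<bullet> (B *v (p - xs)))"
    using mult_left_mono[OF cross_term_lower_bound[of e "p - xs"], of \<alpha>] \<alpha>_pos
    unfolding E_def P_def by (simp add: algebra_simps)
  have "(norm (A *v e))\<^sup>2 \<le> \<rho>A * E"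
    using quadratic_form_le_max_eig[of "transpose A ** A" e]
    unfolding E_def by (simp add: matrix_transpose_mul gram_quadratic_form)
  then have feasibility: "\<alpha> * \<beta> * (norm (A *v e))\<^sup>2 \<le> \<alpha> * \<beta> * \<rho>A * E"
    using \<alpha>_pos \<beta>_pos by (simp add: mult_left_mono)
  have "gap_rate * (D + E + P) \<le> \<alpha> * slack / 2 * D + \<alpha> * slack / 4 * E
    + (\<alpha> * \<rho>B * P - \<alpha> * (4 * \<rho>B\<^sup>2 / (4 * \<rho>B + slack)) * P)"
    by (rule gap_rate_le_weights) (simp_all add: D_def E_def)
  moreover have "\<alpha> * (slack / 2 + \<beta> * \<rho>A + 2 * \<rho>B) * E - \<alpha> * \<rho>B * E
      - \<alpha> * (\<rho>B + slack / 4) * E - \<alpha> * \<beta> * \<rho>A * E = \<alpha> * slack / 4 * E"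
    "(1 + \<alpha> * \<rho>B) * E = E + \<alpha> * \<rho>B * E"
    by (simp_all add: algebra_simps)
  ultimately show ?thesis
    using gap descent cross feasibility
    unfolding e_def[symmetric] D_def[symmetric] E_def[symmetric] P_def[symmetric]
    by linarith
qed

lemma dual_residual_in_range:
  assumes "lam \<in> range ((*v) A)"
  shows "dual_step y p lam - ls \<in> range ((*v) A)"
proof -
  obtain z z' where "lam = A *v z" "ls = A *v z'" using assms ls_range by blast
  then have "(lam - ls) + \<beta> *\<^sub>R (A *v (primal_step y p lam - xs))
      = A *v (z - z' + \<beta> *\<^sub>R (primal_step y p lam - xs))"
    by (simp add: matrix_vector_right_distrib matrix_vector_mult_diff_distrib
        matrix_vector_mult_scaleR)
  then show ?thesis unfolding dual_error by (metis rangeI)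
qed

lemma gradient_step_nonexpansive:
  "(norm ((y - x) - \<alpha> *\<^sub>R (grad y - grad x)))\<^sup>2 \<le> (norm (y - x))\<^sup>2"
  using gradient_step_factor[of y x] mult_left_le_one_le[OF _ gradient_step_factor_bounds]
  by (meson order_trans zero_le_power2)

lemma scaled_dual_residual:
  "\<alpha> *\<^sub>R (transpose A *v (dual_step y p lam - ls))
    = ((y - xs) - \<alpha> *\<^sub>R (grad y - grad xs) - (primal_step y p lam - xs))
      - \<alpha> *\<^sub>R (B *v (p - xs)) + (\<alpha> * \<beta>) *\<^sub>R ((transpose A ** A) *v (primal_step y p lam - xs))"
  using primal_error[of y p lam] unfolding dual_error
  by (simp add: matrix_vector_right_distrib matrix_vector_mult_scaleR matrix_vector_mul_assoc
      algebra_simps)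

lemma dual_residual_bound:
  obtains K where "0 \<le> K" "\<And>y p lam. (norm (transpose A *v (dual_step y p lam - ls)))\<^sup>2
    \<le> K * ((norm (y - xs))\<^sup>2 + (norm (primal_step y p lam - xs))\<^sup>2 + (norm (p - xs))\<^sup>2)"
proof -
  define nB nG where "nB = onorm ((*v) B)" and "nG = onorm ((*v) (transpose A ** A))"
  define K where "K = 3 * (2 + \<alpha>\<^sup>2 * nB\<^sup>2 + (\<alpha> * \<beta>)\<^sup>2 * nG\<^sup>2) / \<alpha>\<^sup>2"
  have "0 \<le> K" unfolding K_def by simp
  moreover have "(norm (transpose A *v (dual_step y p lam - ls)))\<^sup>2
    \<le> K * ((norm (y - xs))\<^sup>2 + (norm (primal_step y p lam - xs))\<^sup>2 + (norm (p - xs))\<^sup>2)"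
    for y p lam
  proof -
    define e u where "e = primal_step y p lam - xs" and "u = (y - xs) - \<alpha> *\<^sub>R (grad y - grad xs)"
    define D E P where "D = (norm (y - xs))\<^sup>2" and "E = (norm e)\<^sup>2" and "P = (norm (p - xs))\<^sup>2"
    have "(norm u)\<^sup>2 \<le> D" unfolding u_def D_def by (rule gradient_step_nonexpansive)
    then have "(norm (u - e))\<^sup>2 \<le> 2 * D + 2 * E"
      using power2_norm_diff_le[of u e] unfolding E_def by linarith
    moreover have "(norm (B *v (p - xs)))\<^sup>2 \<le> nB\<^sup>2 * P"
      unfolding nB_def P_def by (rule power2_norm_matrix_vector_le)
    moreover have "(norm ((transpose A ** A) *v e))\<^sup>2 \<le> nG\<^sup>2 * E"
      unfolding nG_def E_def by (rule power2_norm_matrix_vector_le)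
    moreover have "\<alpha>\<^sup>2 * (norm (transpose A *v (dual_step y p lam - ls)))\<^sup>2
        \<le> 3 * ((norm (u - e))\<^sup>2 + \<alpha>\<^sup>2 * (norm (B *v (p - xs)))\<^sup>2
          + (\<alpha> * \<beta>)\<^sup>2 * (norm ((transpose A ** A) *v e))\<^sup>2)"
    proof -
      have "\<alpha> *\<^sub>R (transpose A *v (dual_step y p lam - ls))
          = (u - e) + - (\<alpha> *\<^sub>R (B *v (p - xs))) + (\<alpha> * \<beta>) *\<^sub>R ((transpose A ** A) *v e)"
        using scaled_dual_residual[of y p lam] unfolding e_def[symmetric] u_def[symmetric] by simp
      then have "\<alpha>\<^sup>2 * (norm (transpose A *v (dual_step y p lam - ls)))\<^sup>2
          = (norm ((u - e) + - (\<alpha> *\<^sub>R (B *v (p - xs))) + (\<alpha> * \<beta>) *\<^sub>R ((transpose A ** A) *v e)))\<^sup>2"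
        by (metis norm_scaleR power2_abs power_mult_distrib)
      also have "\<dots> \<le> 3 * ((norm (u - e))\<^sup>2 + (norm (- (\<alpha> *\<^sub>R (B *v (p - xs)))))\<^sup>2
          + (norm ((\<alpha> * \<beta>) *\<^sub>R ((transpose A ** A) *v e)))\<^sup>2)"
        by (rule power2_norm_add3_le)
      finally show ?thesis by (simp add: power_mult_distrib)
    qed
    ultimately have "\<alpha>\<^sup>2 * (norm (transpose A *v (dual_step y p lam - ls)))\<^sup>2
        \<le> 3 * ((2 * D + 2 * E) + \<alpha>\<^sup>2 * (nB\<^sup>2 * P) + (\<alpha> * \<beta>)\<^sup>2 * (nG\<^sup>2 * E))"
      by (smt (verit) mult_left_mono zero_le_power2)
    also have "\<dots> \<le> \<alpha>\<^sup>2 * (K * (D + E + P))"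
    proof -
      define a b where "a = \<alpha>\<^sup>2 * nB\<^sup>2" and "b = (\<alpha> * \<beta>)\<^sup>2 * nG\<^sup>2"
      have "0 \<le> a" "0 \<le> b" "0 \<le> D" "0 \<le> E" "0 \<le> P"
        unfolding a_def b_def D_def E_def P_def by simp_all
      have "3 * ((2 * D + 2 * E) + \<alpha>\<^sup>2 * (nB\<^sup>2 * P) + (\<alpha> * \<beta>)\<^sup>2 * (nG\<^sup>2 * E))
          = 3 * (2 * D + 2 * E + a * P + b * E)"
        unfolding a_def b_def by (simp add: algebra_simps)
      also have "\<dots> \<le> 3 * ((2 * D + 2 * E + a * P + b * E) + (2 * P + a * D + a * E + b * D + b * P))"
        using \<open>0 \<le> a\<close> \<open>0 \<le> b\<close> \<open>0 \<le> D\<close> \<open>0 \<le> E\<close> \<open>0 \<le> P\<close> by simp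
      also have "\<dots> = \<alpha>\<^sup>2 * (K * (D + E + P))"
        unfolding K_def a_def b_def using \<alpha>_pos by (simp add: field_simps)
      finally show ?thesis .
    qed
    finally show ?thesis
      using \<alpha>_pos unfolding D_def E_def P_def e_def by simp
  qed
  ultimately show ?thesis using that by blast
qed

lemma energy_upper_bound:
  obtains C where "0 < C" "\<And>y p lam. lam \<in> range ((*v) A) \<Longrightarrow>
    (1 + \<alpha> * \<rho>B) * (norm (primal_step y p lam - xs))\<^sup>2 + \<alpha> / \<beta> * (norm (dual_step y p lam - ls))\<^sup>2
      \<le> C * ((norm (y - xs))\<^sup>2 + (norm (primal_step y p lam - xs))\<^sup>2 + (norm (p - xs))\<^sup>2)"
proof -
  obtain \<sigma> where "0 < \<sigma>" and \<sigma>: "\<And>z. \<sigma> * norm (A *v z) \<le> norm (transpose A *v (A *v z))"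
    using transpose_bounded_below_on_range[of A] by blast
  obtain K where "0 \<le> K" and K: "\<And>y p lam. (norm (transpose A *v (dual_step y p lam - ls)))\<^sup>2
    \<le> K * ((norm (y - xs))\<^sup>2 + (norm (primal_step y p lam - xs))\<^sup>2 + (norm (p - xs))\<^sup>2)"
    using dual_residual_bound by blast
  define C where "C = 1 + \<alpha> * \<rho>B + \<alpha> / \<beta> * (K / \<sigma>\<^sup>2)"
  have "0 < C"
    unfolding C_def using \<alpha>_pos \<beta>_pos B_max_eig_pos \<open>0 \<le> K\<close> by (simp add: add_pos_nonneg)
  moreover have "(1 + \<alpha> * \<rho>B) * (norm (primal_step y p lam - xs))\<^sup>2
      + \<alpha> / \<beta> * (norm (dual_step y p lam - ls))\<^sup>2
    \<le> C * ((norm (y - xs))\<^sup>2 + (norm (primal_step y p lam - xs))\<^sup>2 + (norm (p - xs))\<^sup>2)"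
    if lam_range: "lam \<in> range ((*v) A)" for y p lam
  proof -
    define W where "W = (norm (y - xs))\<^sup>2 + (norm (primal_step y p lam - xs))\<^sup>2 + (norm (p - xs))\<^sup>2"
    obtain z where z: "dual_step y p lam - ls = A *v z"
      using dual_residual_in_range[OF lam_range] by blast
    have "(\<sigma> * norm (A *v z))\<^sup>2 \<le> (norm (transpose A *v (A *v z)))\<^sup>2"
      using \<sigma>[of z] \<open>0 < \<sigma>\<close> by (simp add: power_mono)
    then have "\<sigma>\<^sup>2 * (norm (dual_step y p lam - ls))\<^sup>2 \<le> K * W"
      using K[of y p lam] unfolding z W_def by (simp add: power_mult_distrib)
    then have "\<alpha> / \<beta> * (norm (dual_step y p lam - ls))\<^sup>2 \<le> \<alpha> / \<beta> * (K / \<sigma>\<^sup>2) * W"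
      using \<open>0 < \<sigma>\<close> \<alpha>_pos \<beta>_pos by (simp add: field_simps mult_left_mono)
    moreover have "(1 + \<alpha> * \<rho>B) * (norm (primal_step y p lam - xs))\<^sup>2 \<le> (1 + \<alpha> * \<rho>B) * W"
      unfolding W_def using \<alpha>_pos B_max_eig_pos by (simp add: mult_left_mono)
    ultimately show ?thesis unfolding W_def[symmetric] C_def by (simp add: algebra_simps)
  qed
  ultimately show ?thesis using that by blast
qed

theorem one_step_contraction:
  obtains \<delta> where "0 < \<delta>" "\<And>y p lam. lam \<in> range ((*v) A) \<Longrightarrow>
    (1 + \<alpha> * \<rho>B) * (norm (primal_step y p lam - xs))\<^sup>2 + \<alpha> / \<beta> * (norm (dual_step y p lam - ls))\<^sup>2
      \<le> 1 / (1 + \<delta>) * ((norm (y - xs))\<^sup>2 + \<alpha> / \<beta> * (norm (lam - ls))\<^sup>2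
        + \<alpha> * \<rho>B * (norm (p - xs))\<^sup>2)"
proof -
  obtain C where "0 < C" and C: "\<And>y p lam. lam \<in> range ((*v) A) \<Longrightarrow>
    (1 + \<alpha> * \<rho>B) * (norm (primal_step y p lam - xs))\<^sup>2 + \<alpha> / \<beta> * (norm (dual_step y p lam - ls))\<^sup>2
      \<le> C * ((norm (y - xs))\<^sup>2 + (norm (primal_step y p lam - xs))\<^sup>2 + (norm (p - xs))\<^sup>2)"
    using energy_upper_bound by blast
  show ?thesis
  proof (rule that)
    show "0 < gap_rate / C" using gap_rate_pos \<open>0 < C\<close> by simp
    show "(1 + \<alpha> * \<rho>B) * (norm (primal_step y p lam - xs))\<^sup>2
        + \<alpha> / \<beta> * (norm (dual_step y p lam - ls))\<^sup>2
      \<le> 1 / (1 + gap_rate / C) * ((norm (y - xs))\<^sup>2 + \<alpha> / \<beta> * (norm (lam - ls))\<^sup>2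
        + \<alpha> * \<rho>B * (norm (p - xs))\<^sup>2)"
      if "lam \<in> range ((*v) A)" for y p lam
      using le_divide_one_plus_if_gap[OF gap_rate_pos \<open>0 < C\<close> C[OF that]
          energy_gap_lower_bound] .
  qed
qed


theorem iterates_contraction:
  fixes T :: nat and xi :: "nat \<Rightarrow> nat \<Rightarrow> real^'n"
  assumes "1 \<le> T" and "lam 0 = 0"
    and inner_step: "\<And>k t. 1 \<le> t \<Longrightarrow> t \<le> T \<Longrightarrow>
        xi (Suc k) t = xi (Suc k) (t - 1) - \<alpha> *\<^sub>R grad (xi (Suc k) (t - 1))
          - \<alpha> *\<^sub>R (transpose A *v lam k) - \<alpha> *\<^sub>R (B *v x k)"
    and x_step: "\<And>k. x (Suc k) = xi (Suc k) T"
    and lam_step: "\<And>k. lam (Suc k) = lam k + \<beta> *\<^sub>R (A *v x (Suc k))"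
  shows "\<exists>\<delta>>0. \<forall>k. (1 + \<alpha> * \<rho>B) * (norm (xi (Suc k) T - xs))\<^sup>2
            + \<alpha> / \<beta> * (norm (lam (Suc k) - ls))\<^sup>2
          \<le> 1 / (1 + \<delta>) * ((norm (xi (Suc k) (T - 1) - xs))\<^sup>2
            + \<alpha> / \<beta> * (norm (lam k - ls))\<^sup>2 + \<alpha> * \<rho>B * (norm (x k - xs))\<^sup>2)"
proof -
  obtain \<delta> where "0 < \<delta>" and contraction: "\<And>y p lam. lam \<in> range ((*v) A) \<Longrightarrow>
    (1 + \<alpha> * \<rho>B) * (norm (primal_step y p lam - xs))\<^sup>2 + \<alpha> / \<beta> * (norm (dual_step y p lam - ls))\<^sup>2
      \<le> 1 / (1 + \<delta>) * ((norm (y - xs))\<^sup>2 + \<alpha> / \<beta> * (norm (lam - ls))\<^sup>2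
        + \<alpha> * \<rho>B * (norm (p - xs))\<^sup>2)"
    using one_step_contraction by blast
  have primal: "xi (Suc k) T = primal_step (xi (Suc k) (T - 1)) (x k) (lam k)" for k
    using inner_step[of T k] \<open>1 \<le> T\<close> unfolding primal_step_def by simp
  moreover have "lam (Suc k) = dual_step (xi (Suc k) (T - 1)) (x k) (lam k)" for k
    using lam_step[of k] x_step[of k] primal unfolding dual_step_def by simp
  ultimately show ?thesis
    using contraction iterates_in_range[of lam \<beta> A x, OF \<open>lam 0 = 0\<close> lam_step] \<open>0 < \<delta>\<close>
    by auto
qed

end

lemma incidence_ne_zero:
  fixes ends :: "'e::finite \<Rightarrow> 'n::finite \<times> 'n"
  shows "incidence ends \<noteq> 0"
proof -
  have "(incidence ends *v axis (fst (ends undefined)) 1) $ undefined = 1"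
    by (simp add: matrix_vector_mul_component inner_axis incidence_def)
  then show ?thesis by (metis matrix_vector_mult_0 zero_index zero_neq_one)
qed

lemma ne_zero_if_same_kernel:
  fixes B :: "real^'n^'m" and M :: "real^'n^'k"
  assumes "{y. B *v y = 0} = {y. M *v y = 0}" and "M \<noteq> 0"
  shows "B \<noteq> 0"
proof
  assume "B = 0"
  then have "M *v y = 0" for y using assms(1) by (simp add: set_eq_iff)
  then show False using assms(2) by (simp add: matrix_eq)
qed

lemma step_size_slack:
  fixes m L \<alpha> \<beta> \<eta>2 \<eta>3 \<rho>A \<rho>B :: real
  assumes "0 < \<beta>" "0 < m" "m \<le> L" "\<rho>B < \<eta>3" "\<eta>2 + \<eta>3 < 2 * m - \<rho>B"
    and \<alpha>_small: "\<alpha> < \<eta>2 / L\<^sup>2" and \<beta>_small: "\<beta> < (2 * m - (\<eta>2 + \<eta>3) - \<rho>B) / \<rho>A"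
  shows "\<alpha> * L\<^sup>2 + \<beta> * \<rho>A + 2 * \<rho>B < 2 * m"
proof -
  have slack: "0 < 2 * m - (\<eta>2 + \<eta>3) - \<rho>B" using assms(5) by linarith
  have "0 < \<rho>A"
  proof (rule ccontr)
    assume "\<not> 0 < \<rho>A"
    \<comment> \<open>then the bound on \<open>\<beta>\<close> (a junk value if \<open>\<rho>A = 0\<close>) is not positive\<close>
    then have "(2 * m - (\<eta>2 + \<eta>3) - \<rho>B) / \<rho>A \<le> 0" using slack by (simp add: divide_nonneg_nonpos)
    then show False using \<beta>_small \<open>0 < \<beta>\<close> by linarith
  qed
  then have "\<beta> * \<rho>A < 2 * m - (\<eta>2 + \<eta>3) - \<rho>B" using \<beta>_small by (simp add: pos_less_divide_eq)
  moreover have "\<alpha> * L\<^sup>2 < \<eta>2" using \<alpha>_small assms(2,3) by (simp add: pos_less_divide_eq)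
  ultimately show ?thesis using assms(4) by linarith
qed

theorem theorem3p12:
  fixes ends :: "'e::finite \<Rightarrow> 'n::finite \<times> 'n"
    and A :: "real^'n^'e" and B :: "real^'n^'n"
    and f :: "'n \<Rightarrow> real \<Rightarrow> real" and df d2f :: "'n \<Rightarrow> real \<Rightarrow> real"
    and m L \<alpha> \<beta> \<eta>2 \<eta>3 :: real and T :: nat
    and xs :: "real^'n" and ls :: "real^'e"
    and x :: "nat \<Rightarrow> real^'n" and xi :: "nat \<Rightarrow> nat \<Rightarrow> real^'n"
    and lam :: "nat \<Rightarrow> real^'e"
  defines "grad \<equiv> (\<lambda>y::real^'n. \<chi> i. df i (y $ i))"
    and "F \<equiv> (\<lambda>y::real^'n. \<Sum>i\<in>UNIV. f i (y $ i))"
  assumes graph: "simple_graph ends" "connected_graph ends"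
    and A_def: "A = incidence ends"
    and d1: "\<And>i t. (f i has_real_derivative df i t) (at t)"
    and d2: "\<And>i t. (df i has_real_derivative d2f i t) (at t)"
    and m_pos: "0 < m" and m_le_L: "m \<le> L"
    and curv: "\<And>i t. m \<le> d2f i t \<and> d2f i t \<le> L"
    and B_sym: "transpose B = B" and B_psd: "psd B"
    and B_null: "{y. B *v y = 0} = {y. A *v y = 0}"
    and B_sparse: "\<And>i j. i \<noteq> j \<Longrightarrow> B $ i $ j \<noteq> 0 \<Longrightarrow> adjacent ends i j"
    and B_small: "max_eig B < m"
    and xs_feas: "A *v xs = 0"
    and xs_min: "\<And>y. A *v y = 0 \<Longrightarrow> y \<noteq> xs \<Longrightarrow> F xs < F y"
    and ls_kkt: "grad xs + transpose A *v ls = 0" "B *v xs = 0"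
    and ls_col: "ls \<in> range (\<lambda>z. A *v z)"
    and \<alpha>_pos: "0 < \<alpha>" and \<beta>_pos: "0 < \<beta>" and T_pos: "1 \<le> T"
    and lam0: "lam 0 = 0"
    and inner0: "\<And>k. xi (Suc k) 0 = x k"
    and inner_step: "\<And>k t. 1 \<le> t \<Longrightarrow> t \<le> T \<Longrightarrow>
        xi (Suc k) t = xi (Suc k) (t - 1) - \<alpha> *\<^sub>R grad (xi (Suc k) (t - 1))
          - \<alpha> *\<^sub>R (transpose A *v lam k) - \<alpha> *\<^sub>R (B *v x k)"
    and x_step: "\<And>k. x (Suc k) = xi (Suc k) T"
    and lam_step: "\<And>k. lam (Suc k) = lam k + \<beta> *\<^sub>R (A *v x (Suc k))"
    and \<eta>2_pos: "0 < \<eta>2" and \<eta>3_gt: "max_eig B < \<eta>3"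
    and \<eta>_sum: "\<eta>2 + \<eta>3 < 2 * m - max_eig B"
    and \<alpha>_small: "\<alpha> < \<eta>2 / L\<^sup>2"
    and \<beta>_small: "\<beta> < (2 * m - (\<eta>2 + \<eta>3) - max_eig B) / max_eig (transpose A ** A)"
  shows "\<exists>\<delta>>0. \<forall>k. (1 + \<alpha> * max_eig B) * (norm (xi (Suc k) T - xs))\<^sup>2
            + \<alpha> / \<beta> * (norm (lam (Suc k) - ls))\<^sup>2
          \<le> 1 / (1 + \<delta>) * ((norm (xi (Suc k) (T - 1) - xs))\<^sup>2
            + \<alpha> / \<beta> * (norm (lam k - ls))\<^sup>2 + \<alpha> * max_eig B * (norm (x k - xs))\<^sup>2)"
proof -
  have "B \<noteq> 0" using B_null A_def incidence_ne_zero by (metis ne_zero_if_same_kernel)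
  have "flexpd_g A B grad m L \<alpha> \<beta> xs ls"
  proof
    show "m * (norm (y - x))\<^sup>2 \<le> (grad y - grad x) \<bullet> (y - x)" for x y
      unfolding grad_def using curv by (intro separable_gradient_strongly_monotone[OF d2]) blast
    have "0 \<le> d2f i t \<and> d2f i t \<le> L" for i t
      using curv[of i t] m_pos by linarith
    then show "norm (grad y - grad x) \<le> L * norm (y - x)" for x y
      unfolding grad_def by (rule separable_gradient_lipschitz[OF d2])
    show "0 < max_eig B" by (rule max_eig_pos[OF B_sym B_psd \<open>B \<noteq> 0\<close>])
    show "ls \<in> range ((*v) A)" using ls_col by (simp add: image_def)
    show "\<alpha> * L\<^sup>2 + \<beta> * max_eig (transpose A ** A) + 2 * max_eig B < 2 * m"
      by (rule step_size_slack[OF \<beta>_pos m_pos m_le_L \<eta>3_gt \<eta>_sum \<alpha>_small \<beta>_small])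
  qed (fact B_sym B_psd ls_kkt(1) xs_feas ls_kkt(2) \<alpha>_pos \<beta>_pos)+
  then interpret flexpd_g A B grad m L \<alpha> \<beta> xs ls .
  show ?thesis by (rule iterates_contraction[OF T_pos lam0 inner_step x_step lam_step])
qed

end
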